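(* Let $k,n\geq 1$ be integers and define the set of primes $$\mathcal{P}(k,n):=\{ p \text{ prime} : p \,\|\, n,\ p^2-1\mid k,\ p\equiv 3\pmod{4}\}.$$ Then, as a congruence in $\mathbb{Z}[i]$ modulo $n$, $$\mathbf{G}_k(n)\equiv \begin{cases} \frac{n}{2}(1+i) \pmod{n}, & \text{if } k>1 \text{ is odd and } n\equiv 2\pmod{4};\\ \displaystyle -\sum_{p\in\mathcal{P}(k,n)} \frac{n^2}{p^2} \pmod{n}, & \text{otherwise}. \end{cases}$$
   Context: For integers $k,n\ge 1$, $\mathbf{G}_k(n):=\sum_{1\leq a,b\leq n}(a+bi)^k\in\mathbb{Z}[i]$. The notation $p\,\|\,n$ means $p\mid n$ and $p^2\nmid n$. Congruence modulo $n$ in $\mathbb{Z}[i]$ means congruence modulo the ideal $n\mathbb{Z}[i]$. An empty sum is $0$. *)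

theory Defs
  imports Complex_Main "HOL-Computational_Algebra.Primes"
begin

definition gauss_ints :: "complex set" where
  "gauss_ints = {of_int a + of_int b * \<i> | a b. True}"

definition gauss_ideal :: "nat \<Rightarrow> complex set" where
  "gauss_ideal n = {of_nat n * z | z. z \<in> gauss_ints}"

text \<open>
  Both sides are required to be Gaussian integers, so a congruence between expressions
  formed with complex division also asserts that they lie in the ring.
\<close>
definition gauss_cong :: "complex \<Rightarrow> complex \<Rightarrow> nat \<Rightarrow> bool" where
  "gauss_cong z w n \<longleftrightarrow> z \<in> gauss_ints \<and> w \<in> gauss_ints \<and> z - w \<in> gauss_ideal n"

definition gauss_power_sum :: "nat \<Rightarrow> nat \<Rightarrow> complex" where
  "gauss_power_sum k n = (\<Sum>a=1..n. \<Sum>b=1..n. (of_nat a + of_nat b * \<i>) ^ k)"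

definition exactly_dvd :: "nat \<Rightarrow> nat \<Rightarrow> bool" where
  "exactly_dvd p n \<longleftrightarrow> p dvd n \<and> \<not> p\<^sup>2 dvd n"

definition prime_set :: "nat \<Rightarrow> nat \<Rightarrow> nat set" where
  "prime_set k n = {p. prime p \<and> exactly_dvd p n \<and> (p\<^sup>2 - 1) dvd k \<and> p mod 4 = 3}"

end

theory Submission
  imports Defs "HOL-Number_Theory.Euler_Criterion"
begin

text \<open>
  Write \<open>G\<^sub>k(n)\<close> for the power sum. A congruence modulo \<open>n\<close> in \<open>\<int>[\<i>]\<close> may be checked modulo the
  exact power \<open>p\<^sup>e\<close> of every prime \<open>p\<close> dividing \<open>n\<close> (\<open>gauss_cong_prime_powersI\<close>). The box of side
  \<open>n\<close> covers every residue modulo \<open>p\<^sup>e\<close> equally often, so \<open>G\<^sub>k(n) \<equiv> (n / p\<^sup>e)\<^sup>2 G\<^sub>k(p\<^sup>e)\<close> modulo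
  \<open>p\<^sup>e\<close> (\<open>gauss_power_sum_periodic\<close>), and it remains to find \<open>G\<^sub>k(p\<^sup>e)\<close> modulo \<open>p\<^sup>e\<close>.

  For \<open>e \<ge> 2\<close> it is \<open>0\<close>: a first-order expansion shows \<open>G\<^sub>k(p\<^sup>e) \<equiv> p\<^sup>2 G\<^sub>k(p\<^sup>e\<^sup>-\<^sup>1)\<close> modulo \<open>p\<^sup>e\<close>
  (\<open>gauss_power_sum_lift\<close>, \<open>gauss_power_sum_prime_power\<close>). This is why only primes dividing \<open>n\<close>
  exactly once are visible in the result. For \<open>e = 1\<close> there are three kinds of primes.

  \<^item> The ramified prime \<open>2\<close> is computed by hand (\<open>gauss_power_sum_2\<close>). It yields \<open>0\<close> or, for odd
    \<open>k > 1\<close>, the exceptional value \<open>1 + \<i>\<close>.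

  \<^item> For \<open>p \<equiv> 1\<close> modulo \<open>4\<close>, evaluating \<open>\<i>\<close> at a square root \<open>s\<close> of \<open>- 1\<close> modulo \<open>p\<close> turns the sum
    into \<open>p\<close> copies of a one-dimensional power sum. Both roots together detect divisibility by \<open>p\<close>,
    so the sum is \<open>0\<close> (\<open>gauss_power_sum_split_prime\<close>).

  \<^item> For \<open>p \<equiv> 3\<close> modulo \<open>4\<close>, the sum runs over the field with \<open>p\<^sup>2\<close> elements, and it should be
    \<open>- 1\<close> or \<open>0\<close> according to whether \<open>p\<^sup>2 - 1\<close> divides \<open>k\<close>. Instead of a generator of the
    multiplicative group, the proof uses that \<open>z\<^sup>p\<close> is the conjugate of \<open>z\<close>: writing the reduced
    exponent in base \<open>p\<close> makes \<open>z\<^sup>k\<close> a polynomial of small degree in the coordinates, and a degree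
    argument in the style of Chevalley and Warning makes the sum vanish in all cases but the one
    where \<open>z\<^sup>k\<close> is the power \<open>p - 1\<close> of the norm (\<open>gauss_power_sum_inert_prime\<close>).
\<close>

section \<open>Congruences of Gaussian integers\<close>

lemma gauss_ints_iff: "z \<in> gauss_ints \<longleftrightarrow> Re z \<in> \<int> \<and> Im z \<in> \<int>"
proof
  assume "z \<in> gauss_ints"
  then show "Re z \<in> \<int> \<and> Im z \<in> \<int>"
    by (auto simp: gauss_ints_def)
next
  assume "Re z \<in> \<int> \<and> Im z \<in> \<int>"
  then obtain a b where "Re z = of_int a" "Im z = of_int b"
    by (auto elim!: Ints_cases)
  then have "z = of_int a + of_int b * \<i>"
    by (simp add: complex_eq_iff)
  then show "z \<in> gauss_ints"
    by (auto simp: gauss_ints_def)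
qed

lemma gauss_ints_closed [simp, intro]:
  "of_int c \<in> gauss_ints" "of_nat m \<in> gauss_ints" "numeral v \<in> gauss_ints"
  "0 \<in> gauss_ints" "1 \<in> gauss_ints" "\<i> \<in> gauss_ints"
  "z \<in> gauss_ints \<Longrightarrow> w \<in> gauss_ints \<Longrightarrow> z + w \<in> gauss_ints"
  "z \<in> gauss_ints \<Longrightarrow> w \<in> gauss_ints \<Longrightarrow> z - w \<in> gauss_ints"
  "z \<in> gauss_ints \<Longrightarrow> - z \<in> gauss_ints"
  "z \<in> gauss_ints \<Longrightarrow> cnj z \<in> gauss_ints"
  "z \<in> gauss_ints \<Longrightarrow> w \<in> gauss_ints \<Longrightarrow> z * w \<in> gauss_ints"
  by (auto simp: gauss_ints_iff)

lemma gauss_ints_power [simp, intro]: "z \<in> gauss_ints \<Longrightarrow> z ^ k \<in> gauss_ints"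
  by (induction k) auto

lemma gauss_ints_sum [simp, intro]: "(\<And>x. x \<in> A \<Longrightarrow> f x \<in> gauss_ints) \<Longrightarrow> sum f A \<in> gauss_ints"
  by (induction A rule: infinite_finite_induct) auto

lemma gauss_power_sum_in_gauss_ints [simp, intro]: "gauss_power_sum k n \<in> gauss_ints"
  unfolding gauss_power_sum_def by (intro gauss_ints_sum gauss_ints_power) auto

lemma gauss_congI:
  assumes "z \<in> gauss_ints" "w \<in> gauss_ints" "u \<in> gauss_ints" "z - w = of_nat n * u"
  shows "gauss_cong z w n"
  using assms by (auto simp: gauss_cong_def gauss_ideal_def)

lemma gauss_congE:
  assumes "gauss_cong z w n"
  obtains u where "z \<in> gauss_ints" "w \<in> gauss_ints" "u \<in> gauss_ints" "z = w + of_nat n * u"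
proof -
  from assms obtain u where "z \<in> gauss_ints" "w \<in> gauss_ints" "u \<in> gauss_ints" "z - w = of_nat n * u"
    by (auto simp: gauss_cong_def gauss_ideal_def)
  then show ?thesis
    using that[of u] by (simp add: algebra_simps)
qed

lemma gauss_cong_refl [simp, intro]: "z \<in> gauss_ints \<Longrightarrow> gauss_cong z z n"
  by (rule gauss_congI[where u = 0]) auto

lemma gauss_cong_sym: "gauss_cong z w n \<Longrightarrow> gauss_cong w z n"
proof (erule gauss_congE)
  fix u assume u: "z \<in> gauss_ints" "w \<in> gauss_ints" "u \<in> gauss_ints" "z = w + of_nat n * u"
  then show "gauss_cong w z n"
    by (intro gauss_congI[where u = "- u"]) auto
qed

lemma gauss_cong_add:
  assumes "gauss_cong z w n" "gauss_cong z' w' n"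
  shows "gauss_cong (z + z') (w + w') n"
proof -
  obtain u where u: "z \<in> gauss_ints" "w \<in> gauss_ints" "u \<in> gauss_ints" "z = w + of_nat n * u"
    using assms(1) by (rule gauss_congE)
  obtain u' where u': "z' \<in> gauss_ints" "w' \<in> gauss_ints" "u' \<in> gauss_ints" "z' = w' + of_nat n * u'"
    using assms(2) by (rule gauss_congE)
  show ?thesis
  proof (rule gauss_congI[where u = "u + u'"])
    show "z + z' - (w + w') = of_nat n * (u + u')"
      using u(4) u'(4) by (simp add: algebra_simps)
  qed (use u(1-3) u'(1-3) in auto)
qed

lemma gauss_cong_mult:
  assumes "gauss_cong z w n" "gauss_cong z' w' n"
  shows "gauss_cong (z * z') (w * w') n"
proof -
  obtain u where u: "z \<in> gauss_ints" "w \<in> gauss_ints" "u \<in> gauss_ints" "z = w + of_nat n * u"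
    using assms(1) by (rule gauss_congE)
  obtain u' where u': "z' \<in> gauss_ints" "w' \<in> gauss_ints" "u' \<in> gauss_ints" "z' = w' + of_nat n * u'"
    using assms(2) by (rule gauss_congE)
  show ?thesis
  proof (rule gauss_congI[where u = "u * z' + w * u'"])
    show "z * z' - w * w' = of_nat n * (u * z' + w * u')"
      using u(4) u'(4) by (simp add: algebra_simps)
  qed (use u(1-3) u'(1-3) in auto)
qed

lemma gauss_cong_trans [trans]:
  assumes "gauss_cong z w n" "gauss_cong w x n"
  shows "gauss_cong z x n"
proof -
  have "z \<in> gauss_ints" "x \<in> gauss_ints" "w \<in> gauss_ints"
    using assms by (auto simp: gauss_cong_def)
  moreover have "gauss_cong (z + w + (- w)) (w + x + (- w)) n"
    by (intro gauss_cong_add assms gauss_cong_refl gauss_ints_closed \<open>w \<in> gauss_ints\<close>)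
  ultimately show ?thesis
    by simp
qed

lemma gauss_cong_uminus:
  assumes "gauss_cong z w n"
  shows "gauss_cong (- z) (- w) n"
  using gauss_cong_mult[OF gauss_cong_refl[of "- 1"] assms] by simp

lemma gauss_cong_diff:
  assumes "gauss_cong z w n" "gauss_cong z' w' n"
  shows "gauss_cong (z - z') (w - w') n"
  using gauss_cong_add[OF assms(1) gauss_cong_uminus[OF assms(2)]] by simp

lemma gauss_cong_power: "gauss_cong z w n \<Longrightarrow> gauss_cong (z ^ k) (w ^ k) n"
  by (induction k) (auto intro: gauss_cong_mult)

lemma gauss_cong_sum:
  "(\<And>x. x \<in> A \<Longrightarrow> gauss_cong (f x) (g x) n) \<Longrightarrow> gauss_cong (sum f A) (sum g A) n"
  by (induction A rule: infinite_finite_induct) (auto intro: gauss_cong_add)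

lemma gauss_cong_sum_0:
  "(\<And>x. x \<in> A \<Longrightarrow> gauss_cong (f x) 0 n) \<Longrightarrow> gauss_cong (sum f A) 0 n"
  using gauss_cong_sum[of A f "\<lambda>_. 0" n] by simp

lemma gauss_cong_mult_0:
  "gauss_cong z 0 n \<Longrightarrow> w \<in> gauss_ints \<Longrightarrow> gauss_cong (w * z) 0 n"
  using gauss_cong_mult[OF gauss_cong_refl, of w z 0 n] by simp

lemma gauss_cong_mono:
  assumes "gauss_cong z w n" "m dvd n"
  shows "gauss_cong z w m"
proof -
  obtain u where u: "z \<in> gauss_ints" "w \<in> gauss_ints" "u \<in> gauss_ints" "z = w + of_nat n * u"
    using assms(1) by (rule gauss_congE)
  obtain r where "n = m * r"
    using assms(2) by blast
  with u show ?thesis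
    by (intro gauss_congI[where u = "of_nat r * u"]) auto
qed

lemma of_nat_mult_gauss_cong_0:
  "n dvd c \<Longrightarrow> z \<in> gauss_ints \<Longrightarrow> gauss_cong (of_nat c * z) 0 n"
  by (elim dvdE, rule gauss_congI[where u = "of_nat (c div n) * z"]) auto

lemma of_int_gauss_cong:
  assumes "[a = b] (mod int n)"
  shows "gauss_cong (of_int a) (of_int b) n"
proof -
  obtain r where "a - b = int n * r"
    using assms by (auto simp: cong_iff_dvd_diff)
  then have "of_int a - of_int b = (of_nat n * of_int r :: complex)"
    by (metis of_int_diff of_int_mult of_int_of_nat_eq)
  then show ?thesis
    by (intro gauss_congI[where u = "of_int r"]) auto
qed

lemma of_nat_gauss_cong:
  assumes "[a = b] (mod n)"
  shows "gauss_cong (of_nat a) (of_nat b) n"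
  using of_int_gauss_cong[of "int a" "int b" n] assms by (simp add: cong_int_iff)

lemma gauss_cong_iff_dvd:
  "gauss_cong (of_int a + of_int b * \<i>) 0 n \<longleftrightarrow> int n dvd a \<and> int n dvd b"
proof
  assume "gauss_cong (of_int a + of_int b * \<i>) 0 n"
  then obtain u where u: "u \<in> gauss_ints" "of_int a + of_int b * \<i> = of_nat n * u"
    by (auto elim: gauss_congE)
  then obtain c d where "u = of_int c + of_int d * \<i>"
    by (auto simp: gauss_ints_def)
  with u(2) have "real_of_int a = real_of_int (int n * c)" "real_of_int b = real_of_int (int n * d)"
    by (simp_all add: complex_eq_iff)
  then have "a = int n * c" "b = int n * d"
    by (simp_all only: of_int_eq_iff)
  then show "int n dvd a \<and> int n dvd b"
    by simp
next
  assume "int n dvd a \<and> int n dvd b"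
  then obtain c d where "a = int n * c" "b = int n * d"
    by (auto elim!: dvdE)
  then show "gauss_cong (of_int a + of_int b * \<i>) 0 n"
    by (intro gauss_congI[where u = "of_int c + of_int d * \<i>"]) (auto simp: algebra_simps)
qed

text \<open>
  Multiplying by a rational integer multiplies both coordinates, so the cancellation takes
  place separately in the real and in the imaginary part.
\<close>

lemma gauss_cong_cancel:
  assumes "gauss_cong (of_int c * z) 0 n" "z \<in> gauss_ints" "coprime c (int n)"
  shows "gauss_cong z 0 n"
proof -
  obtain a b where z: "z = of_int a + of_int b * \<i>"
    using assms(2) by (auto simp: gauss_ints_def)
  have "of_int c * z = of_int (c * a) + of_int (c * b) * \<i>"
    by (simp add: z algebra_simps)
  with assms(1) have "int n dvd c * a" "int n dvd c * b"
    by (metis gauss_cong_iff_dvd)+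
  with assms(3) show ?thesis
    by (simp add: z gauss_cong_iff_dvd coprime_dvd_mult_right_iff coprime_commute)
qed

text \<open>
  The ideal \<open>n \<int>[\<i>]\<close> consists of the numbers both of whose coordinates are divisible by \<open>n\<close>.
  So a congruence can be tested one rational prime power at a time, with no need to factor
  the rational primes any further in \<open>\<int>[\<i>]\<close>.
\<close>

lemma gauss_cong_prime_powersI:
  assumes "n > 0" "z \<in> gauss_ints" "w \<in> gauss_ints"
    and "\<And>p. prime p \<Longrightarrow> p dvd n \<Longrightarrow> gauss_cong z w (p ^ multiplicity p n)"
  shows "gauss_cong z w n"
proof -
  have "z - w \<in> gauss_ints"
    using assms by auto
  then obtain a b where ab: "z - w = of_int a + of_int b * \<i>"
    by (auto simp: gauss_ints_def)
  have *: "int (p ^ multiplicity p n) dvd a \<and> int (p ^ multiplicity p n) dvd b" if "prime p" for p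
  proof (cases "p dvd n")
    case True
    have "gauss_cong (z - w) (w - w) (p ^ multiplicity p n)"
      using assms that True by (intro gauss_cong_diff) auto
    then show ?thesis
      by (simp add: ab gauss_cong_iff_dvd)
  qed (simp add: not_dvd_imp_multiplicity_0)
  have dvd: "int n dvd c" if c: "\<And>p. prime p \<Longrightarrow> int (p ^ multiplicity p n) dvd c" for c
  proof (cases "c = 0")
    case False
    have "n dvd nat \<bar>c\<bar>"
    proof (rule multiplicity_le_imp_dvd)
      fix p :: nat assume p: "prime p"
      have "p ^ multiplicity p n dvd nat \<bar>c\<bar>"
        using c[OF p] by (simp add: dvd_nat_abs_iff)
      then show "multiplicity p n \<le> multiplicity p (nat \<bar>c\<bar>)"
        using p False by (intro multiplicity_geI) auto
    qed (use assms(1) in auto)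
    then show ?thesis
      by (simp add: dvd_nat_abs_iff)
  qed auto
  have "gauss_cong (z - w) 0 n"
    unfolding ab gauss_cong_iff_dvd using * dvd by blast
  from gauss_cong_add[OF this gauss_cong_refl[OF assms(3)]] show ?thesis
    by simp
qed

section \<open>Periodicity and prime powers\<close>

lemma sum_blocks:
  fixes f :: "nat \<Rightarrow> 'a :: comm_monoid_add"
  shows "(\<Sum>a=1..m*q. f a) = (\<Sum>a=1..m. \<Sum>c<q. f (a + m * c))"
proof (induction q)
  case (Suc q)
  have "(\<Sum>a=1..m * Suc q. f a) = (\<Sum>a=1..m*q + m. f a)"
    by (simp add: add.commute)
  also have "\<dots> = (\<Sum>a=1..m*q. f a) + (\<Sum>a=m*q+1..m*q + m. f a)"
    by (subst sum.ub_add_nat) auto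
  also have "(\<Sum>a=m*q+1..m*q + m. f a) = (\<Sum>a=1..m. f (a + m*q))"
    using sum.shift_bounds_cl_nat_ivl[of f 1 "m*q" m] by (simp add: add.commute)
  also have "(\<Sum>a=1..m*q. f a) = (\<Sum>a=1..m. \<Sum>c<q. f (a + m * c))"
    by (rule Suc.IH)
  finally show ?case
    by (simp add: sum.distrib)
qed simp

text \<open>
  Each pair of coordinates up to \<open>m q\<close> is written as a pair \<open>(a, b)\<close> in the box of side \<open>m\<close> plus
  \<open>m\<close> times a pair of ``leading digits'' \<open>(c, d)\<close>.
\<close>

lemma gauss_power_sum_blocks:
  "gauss_power_sum k (m * q) = (\<Sum>a=1..m. \<Sum>b=1..m. \<Sum>c<q. \<Sum>d<q.
     ((of_nat a + of_nat b * \<i>) + of_nat m * (of_nat c + of_nat d * \<i>)) ^ k)"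
proof -
  have "gauss_power_sum k (m * q) = (\<Sum>a=1..m. \<Sum>c<q. \<Sum>b=1..m. \<Sum>d<q.
          (of_nat (a + m * c) + of_nat (b + m * d) * \<i>) ^ k)"
    unfolding gauss_power_sum_def sum_blocks ..
  also have "\<dots> = (\<Sum>a=1..m. \<Sum>b=1..m. \<Sum>c<q. \<Sum>d<q.
          (of_nat (a + m * c) + of_nat (b + m * d) * \<i>) ^ k)"
    by (intro sum.cong refl sum.swap)
  finally show ?thesis
    by (simp add: algebra_simps)
qed

lemma gauss_power_sum_periodic:
  "gauss_cong (gauss_power_sum k (m * q)) ((of_nat q)\<^sup>2 * gauss_power_sum k m) m"
proof -
  have "gauss_cong (\<Sum>c<q. \<Sum>d<q. (z + of_nat m * (of_nat c + of_nat d * \<i>)) ^ k)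
          (\<Sum>c<q. \<Sum>d<q. z ^ k) m" if "z \<in> gauss_ints" for z
    by (intro gauss_cong_sum gauss_cong_power gauss_congI[OF _ that, where u = "of_nat _ + of_nat _ * \<i>"])
       (use that in auto)
  then have "gauss_cong (gauss_power_sum k (m * q))
          (\<Sum>a=1..m. \<Sum>b=1..m. \<Sum>c<q. \<Sum>d<q. (of_nat a + of_nat b * \<i>) ^ k) m"
    unfolding gauss_power_sum_blocks
    by (rule gauss_cong_sum[OF gauss_cong_sum]) auto
  then show ?thesis
    by (simp add: gauss_power_sum_def sum_distrib_left power2_eq_square mult.assoc)
qed

lemma power_first_order:
  assumes "x \<in> gauss_ints" "y \<in> gauss_ints"
  shows "gauss_cong ((x + of_nat m * y) ^ Suc j)
           (x ^ Suc j + of_nat (Suc j) * x ^ j * (of_nat m * y)) (m\<^sup>2)"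
proof (induction j)
  case 0
  show ?case using assms by auto
next
  case (Suc j)
  let ?h = "of_nat m * y"
  have "gauss_cong ((x + ?h) ^ Suc j * (x + ?h))
          ((x ^ Suc j + of_nat (Suc j) * x ^ j * ?h) * (x + ?h)) (m\<^sup>2)"
    using assms by (intro gauss_cong_mult Suc.IH gauss_cong_refl) auto
  also have "gauss_cong ((x ^ Suc j + of_nat (Suc j) * x ^ j * ?h) * (x + ?h))
      (x ^ Suc (Suc j) + of_nat (Suc (Suc j)) * x ^ Suc j * ?h) (m\<^sup>2)"
    using assms by (intro gauss_congI[where u = "of_nat (Suc j) * x ^ j * y\<^sup>2"])
      (auto simp: algebra_simps power2_eq_square)
  finally show ?case
    by (simp add: mult.commute)
qed

text \<open>
  Periodicity alone gives this congruence only modulo \<open>m\<close>. To gain the factor \<open>q\<close>, the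
  powers are expanded to first order in the leading digits. As \<open>m q\<close> divides \<open>m\<^sup>2\<close>, nothing
  beyond the linear term matters, and the linear term is \<open>m\<close> times the sum of all the leading
  digits, which is a multiple of \<open>q\<close> because each coordinate takes every value \<open>q\<close> times.
\<close>

lemma gauss_power_sum_lift:
  assumes "k \<ge> 1" "q dvd m"
  shows "gauss_cong (gauss_power_sum k (m * q)) ((of_nat q)\<^sup>2 * gauss_power_sum k m) (m * q)"
proof -
  obtain j where k: "k = Suc j"
    using assms(1) by (cases k) auto
  define T :: complex where "T = (\<Sum>c<q. of_nat c)"
  have T: "T \<in> gauss_ints"
    by (auto simp: T_def)
  have residues: "(\<Sum>c<q. \<Sum>d<q. of_nat c + of_nat d * \<i>) = of_nat q * (T * (1 + \<i>))"
    by (simp add: T_def sum.distrib sum_distrib_left sum_distrib_right algebra_simps)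
  have "gauss_cong (\<Sum>c<q. \<Sum>d<q. (z + of_nat m * (of_nat c + of_nat d * \<i>)) ^ k)
          (\<Sum>c<q. \<Sum>d<q. z ^ k) (m * q)" if z: "z \<in> gauss_ints" for z
  proof -
    let ?y = "\<lambda>c d. of_nat c + of_nat d * \<i> :: complex"
    have "m * q dvd m\<^sup>2"
      using assms(2) by (auto simp: power2_eq_square)
    then have "gauss_cong (\<Sum>c<q. \<Sum>d<q. (z + of_nat m * ?y c d) ^ k)
            (\<Sum>c<q. \<Sum>d<q. z ^ k + of_nat k * z ^ j * (of_nat m * ?y c d)) (m * q)"
      unfolding k
      by (intro gauss_cong_sum gauss_cong_mono[OF power_first_order]) (use z in auto)
    also have "(\<Sum>c<q. \<Sum>d<q. z ^ k + of_nat k * z ^ j * (of_nat m * ?y c d)) =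
        (\<Sum>c<q. \<Sum>d<q. z ^ k) + of_nat k * z ^ j * of_nat m * (\<Sum>c<q. \<Sum>d<q. ?y c d)"
      by (simp add: sum.distrib flip: sum_distrib_left mult.assoc)
    also have "gauss_cong ((\<Sum>c<q. \<Sum>d<q. z ^ k) +
        of_nat k * z ^ j * of_nat m * (\<Sum>c<q. \<Sum>d<q. ?y c d)) (\<Sum>c<q. \<Sum>d<q. z ^ k) (m * q)"
      unfolding residues
      by (rule gauss_congI[where u = "of_nat k * z ^ j * (T * (1 + \<i>))"]) (use z T in auto)
    finally show ?thesis .
  qed
  then have "gauss_cong (gauss_power_sum k (m * q))
          (\<Sum>a=1..m. \<Sum>b=1..m. \<Sum>c<q. \<Sum>d<q. (of_nat a + of_nat b * \<i>) ^ k) (m * q)"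
    unfolding gauss_power_sum_blocks
    by (rule gauss_cong_sum[OF gauss_cong_sum]) auto
  then show ?thesis
    by (simp add: gauss_power_sum_def sum_distrib_left power2_eq_square mult.assoc)
qed

text \<open>
  Each step from \<open>p\<^sup>e\<close> to \<open>p\<^sup>e\<^sup>+\<^sup>1\<close> multiplies the sum by \<open>p\<^sup>2\<close>, while the modulus grows by one
  factor \<open>p\<close> only. The step from \<open>p\<close> to \<open>p\<^sup>2\<close> therefore already produces \<open>0\<close>, whatever the sum
  for \<open>p\<close> may be.
\<close>

lemma gauss_power_sum_prime_power:
  assumes "k \<ge> 1" "e \<ge> 2"
  shows "gauss_cong (gauss_power_sum k (p ^ e)) 0 (p ^ e)"
  using assms(2)
proof (induction e rule: dec_induct)
  case base
  have "gauss_cong (gauss_power_sum k (p * p)) ((of_nat p)\<^sup>2 * gauss_power_sum k p) (p * p)"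
    by (rule gauss_power_sum_lift) (use assms in auto)
  also have "gauss_cong ((of_nat p)\<^sup>2 * gauss_power_sum k p) 0 (p * p)"
    using of_nat_mult_gauss_cong_0[of "p * p" "p\<^sup>2" "gauss_power_sum k p"]
    by (simp add: power2_eq_square gauss_power_sum_in_gauss_ints)
  finally show ?case
    by (simp add: power2_eq_square)
next
  case (step e)
  have "gauss_cong (gauss_power_sum k (p ^ e * p)) ((of_nat p)\<^sup>2 * gauss_power_sum k (p ^ e)) (p ^ e * p)"
    using assms step.hyps by (intro gauss_power_sum_lift) auto
  also obtain u where u: "u \<in> gauss_ints" "gauss_power_sum k (p ^ e) = of_nat (p ^ e) * u"
    using step.IH by (auto elim: gauss_congE)
  have "gauss_cong ((of_nat p)\<^sup>2 * gauss_power_sum k (p ^ e)) 0 (p ^ e * p)"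
    using u by (intro gauss_congI[where u = "of_nat p * u"]) (auto simp: power2_eq_square)
  finally show ?case
    by (simp add: mult.commute)
qed

section \<open>Inert primes\<close>

text \<open>
  Summing \<open>(a + 1)\<^sup>i\<^sup>+\<^sup>1 - a\<^sup>i\<^sup>+\<^sup>1\<close> telescopes to a multiple of \<open>p\<close>. By the binomial theorem the same
  sum is a combination of the power sums of exponents up to \<open>i\<close>, in which the one of exponent
  \<open>i\<close> has the coefficient \<open>i + 1\<close>. That coefficient is invertible modulo \<open>p\<close> because
  \<open>i < p - 1\<close>, so induction applies.
\<close>

lemma sum_powers_mod_prime:
  fixes p :: nat
  assumes "prime p" "i < p - 1"
  shows "p dvd (\<Sum>a=1..p. a ^ i)"
  using assms(2)
proof (induction i rule: less_induct)
  case (less i)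
  let ?S = "\<lambda>j. \<Sum>a=1..p. a ^ j"
  have telescope: "(\<Sum>a=1..m. (a + 1) ^ Suc i) + 1 = (\<Sum>a=1..m. a ^ Suc i) + (m + 1) ^ Suc i" for m :: nat
    by (induction m) (simp_all del: power_Suc)
  \<comment> \<open>The same sum by the binomial theorem; the terms of exponent \<open>i + 1\<close> cancel.\<close>
  have "(\<Sum>a=1..p. (a + 1) ^ Suc i) = (\<Sum>a=1..p. \<Sum>j\<le>Suc i. (Suc i choose j) * a ^ j)"
    by (simp only: binomial) simp
  also have "\<dots> = (\<Sum>j\<le>Suc i. (Suc i choose j) * ?S j)"
    by (subst sum.swap) (simp only: sum_distrib_left)
  also have "\<dots> = ?S (Suc i) + (Suc i * ?S i + (\<Sum>j<i. (Suc i choose j) * ?S j))"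
    by (simp add: lessThan_Suc_atMost[symmetric])
  finally have sum_eq: "(p + 1) ^ Suc i - 1 = Suc i * ?S i + (\<Sum>j<i. (Suc i choose j) * ?S j)"
    using telescope[of p] by linarith
  have "[(p + 1) ^ Suc i = 1 ^ Suc i] (mod p)"
    by (intro cong_pow) (unfold cong_def, rule mod_add_self1)
  then have "p dvd (p + 1) ^ Suc i - 1"
    by (metis cong_altdef_nat cong_sym one_le_power le_add2 power_one)
  moreover have "p dvd (\<Sum>j<i. (Suc i choose j) * ?S j)"
    by (rule dvd_sum, rule dvd_mult, rule less.IH) (use less.prems in auto)
  ultimately have "p dvd Suc i * ?S i"
    unfolding sum_eq using dvd_add_left_iff by blast
  moreover have "\<not> p dvd Suc i"
    using less.prems by (auto dest: dvd_imp_le)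
  ultimately show ?case
    using assms(1) prime_dvd_mult_iff by blast
qed

text \<open>
  This is the degree argument behind the Chevalley--Warning theorem. As a polynomial in \<open>a\<close> and
  \<open>b\<close> the summand has total degree below \<open>2 (p - 1)\<close>, so in each of its monomials one of the two
  variables has an exponent below \<open>p - 1\<close>, and summing over that variable gives \<open>0\<close>.
\<close>

lemma sum_conj_monomials_vanish:
  assumes "prime p" "k\<^sub>0 + k\<^sub>1 < 2 * (p - 1)"
  shows "gauss_cong (\<Sum>a=1..p. \<Sum>b=1..p.
      (of_nat a + of_nat b * \<i>) ^ k\<^sub>0 * (of_nat a - of_nat b * \<i>) ^ k\<^sub>1) 0 p"
proof -
  let ?u = "\<lambda>i j. of_nat (k\<^sub>0 choose i) * of_nat (k\<^sub>1 choose j) * \<i> ^ (k\<^sub>0 - i) * (- \<i>) ^ (k\<^sub>1 - j)"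
  let ?r = "\<lambda>i j. (k\<^sub>0 - i) + (k\<^sub>1 - j)"
  let ?S = "\<lambda>i. \<Sum>a=1..p. a ^ i"
  have expand: "(of_nat a + of_nat b * \<i>) ^ k\<^sub>0 * (of_nat a - of_nat b * \<i>) ^ k\<^sub>1 =
      (\<Sum>i\<le>k\<^sub>0. \<Sum>j\<le>k\<^sub>1. ?u i j * of_nat (a ^ (i + j)) * of_nat (b ^ ?r i j))" for a b
  proof -
    have "(of_nat a + of_nat b * \<i>) ^ k\<^sub>0 * (of_nat a + of_nat b * (- \<i>)) ^ k\<^sub>1 =
      (\<Sum>i\<le>k\<^sub>0. \<Sum>j\<le>k\<^sub>1. ?u i j * of_nat (a ^ (i + j)) * of_nat (b ^ ?r i j))"
      unfolding binomial_ring sum_product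
      by (intro sum.cong refl)
        (simp only: power_mult_distrib power_add of_nat_mult of_nat_power mult_ac)
    then show ?thesis
      by simp
  qed
  have "(\<Sum>a=1..p. \<Sum>b=1..p. (of_nat a + of_nat b * \<i>) ^ k\<^sub>0 * (of_nat a - of_nat b * \<i>) ^ k\<^sub>1) =
      (\<Sum>i\<le>k\<^sub>0. \<Sum>j\<le>k\<^sub>1. \<Sum>a=1..p. \<Sum>b=1..p. ?u i j * of_nat (a ^ (i + j)) * of_nat (b ^ ?r i j))"
    unfolding expand
    by (simp only: sum.swap[of _ "{1..p}" "{..k\<^sub>0}"] sum.swap[of _ "{1..p}" "{..k\<^sub>1}"])
  also have "\<dots> = (\<Sum>i\<le>k\<^sub>0. \<Sum>j\<le>k\<^sub>1. of_nat (?S (i + j) * ?S (?r i j)) * ?u i j)"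
  proof (intro sum.cong refl)
    fix i j
    have "(\<Sum>a=1..p. \<Sum>b=1..p. ?u i j * of_nat (a ^ (i + j)) * of_nat (b ^ ?r i j)) =
        ?u i j * ((\<Sum>a=1..p. of_nat (a ^ (i + j))) * (\<Sum>b=1..p. of_nat (b ^ ?r i j)))"
      unfolding sum_product by (simp only: sum_distrib_left mult.assoc)
    then show "(\<Sum>a=1..p. \<Sum>b=1..p. ?u i j * of_nat (a ^ (i + j)) * of_nat (b ^ ?r i j)) =
        of_nat (?S (i + j) * ?S (?r i j)) * ?u i j"
      by (simp only: of_nat_mult of_nat_sum mult_ac)
  qed
  finally have eq: "(\<Sum>a=1..p. \<Sum>b=1..p. (of_nat a + of_nat b * \<i>) ^ k\<^sub>0 * (of_nat a - of_nat b * \<i>) ^ k\<^sub>1) =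
      (\<Sum>i\<le>k\<^sub>0. \<Sum>j\<le>k\<^sub>1. of_nat (?S (i + j) * ?S (?r i j)) * ?u i j)" .
  show ?thesis
    unfolding eq
  proof (intro gauss_cong_sum_0 of_nat_mult_gauss_cong_0)
    fix i j assume "i \<in> {..k\<^sub>0}" "j \<in> {..k\<^sub>1}"
    then have "(i + j) + ?r i j = k\<^sub>0 + k\<^sub>1"
      by auto
    then have "i + j < p - 1 \<or> ?r i j < p - 1"
      using assms(2) by linarith
    then show "p dvd ?S (i + j) * ?S (?r i j)"
      using sum_powers_mod_prime[OF assms(1)] by (auto intro: dvd_mult dvd_mult2)
  qed auto
qed

text \<open>
  For an inert prime the Frobenius map of the field with \<open>p\<^sup>2\<close> elements is complex
  conjugation: the mixed binomial terms vanish, Fermat's little theorem fixes the coordinates,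
  and \<open>\<i>\<^sup>p = - \<i>\<close> because \<open>p \<equiv> 3\<close> modulo \<open>4\<close>.
\<close>

lemma gauss_frobenius:
  assumes "prime p" "p mod 4 = 3"
  shows "gauss_cong ((of_nat a + of_nat b * \<i>) ^ p) (of_nat a - of_nat b * \<i>) p"
proof -
  have fermat: "gauss_cong (of_nat c ^ p) (of_nat c) p" for c
  proof -
    have "[c ^ p = c] (mod p)"
    proof (cases "p dvd c")
      case False
      have "[c ^ (p - 1) * c = 1 * c] (mod p)"
        by (intro cong_mult fermat_theorem assms False cong_refl)
      then show ?thesis
        using prime_gt_0_nat[OF assms(1)] by (simp flip: power_Suc2)
    next
      case True
      then show ?thesis
        using prime_gt_0_nat[OF assms(1)] by (simp add: cong_def mod_eq_0_iff_dvd dvd_power_le dvd_trans[OF True dvd_power])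
    qed
    then show ?thesis
      using of_nat_gauss_cong[of "c ^ p" c p] by simp
  qed
  have i_power: "\<i> ^ p = - \<i>"
  proof -
    have "\<i> ^ p = \<i> ^ (4 * (p div 4) + 3)"
      using assms(2) by (metis mult_div_mod_eq)
    then show ?thesis
      by (simp add: power_add power_mult) (simp add: eval_nat_numeral)
  qed
  let ?t = "\<lambda>j. of_nat (p choose j) * of_nat a ^ j * (of_nat b * \<i>) ^ (p - j) :: complex"
  have "{..p} = insert 0 (insert p {1..<p})"
    using prime_gt_0_nat[OF assms(1)] by auto
  then have "(of_nat a + of_nat b * \<i>) ^ p = (of_nat a ^ p + of_nat b ^ p * \<i> ^ p) + (\<Sum>j\<in>{1..<p}. ?t j)"
    using prime_gt_0_nat[OF assms(1)] by (simp add: binomial_ring power_mult_distrib)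
  also have "gauss_cong ((of_nat a ^ p + of_nat b ^ p * \<i> ^ p) + (\<Sum>j\<in>{1..<p}. ?t j))
      ((of_nat a + of_nat b * \<i> ^ p) + 0) p"
  proof (intro gauss_cong_add gauss_cong_mult gauss_cong_sum_0 fermat gauss_cong_refl)
    fix j assume "j \<in> {1..<p}"
    then have "p dvd (p choose j)"
      using assms(1) by (intro dvd_choose_prime) auto
    then show "gauss_cong (?t j) 0 p"
      unfolding mult.assoc by (intro of_nat_mult_gauss_cong_0) auto
  qed auto
  finally show ?thesis
    by (simp add: i_power)
qed

text \<open>
  Conjugating twice gives \<open>z\<^bsup>p\<^sup>2\<^esup> \<equiv> z\<close>. Keeping the remaining exponent \<open>r\<close> positive makes the
  statement true for multiples of \<open>p\<close> as well, so that no division is involved.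
\<close>

lemma gauss_power_mod_period:
  assumes "prime p" "p mod 4 = 3" "r \<ge> 1"
  shows "gauss_cong ((of_nat a + of_nat b * \<i>) ^ (r + (p\<^sup>2 - 1) * t)) ((of_nat a + of_nat b * \<i>) ^ r) p"
proof (induction t)
  case (Suc t)
  let ?z = "of_nat a + of_nat b * \<i>"
  have conj_frobenius: "gauss_cong ((of_nat a - of_nat b * \<i>) ^ p) ?z p"
  proof -
    obtain u where u: "u \<in> gauss_ints" "?z ^ p = (of_nat a - of_nat b * \<i>) + of_nat p * u"
      using gauss_frobenius[OF assms(1,2), of a b] by (auto elim: gauss_congE)
    have "cnj (?z ^ p) = cnj ((of_nat a - of_nat b * \<i>) + of_nat p * u)"
      by (simp only: u(2))
    then show ?thesis
      using u(1) by (intro gauss_congI[where u = "cnj u"]) auto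
  qed
  have "gauss_cong ((?z ^ p) ^ p) ((of_nat a - of_nat b * \<i>) ^ p) p"
    by (intro gauss_cong_power gauss_frobenius assms)
  also note conj_frobenius
  finally have frobenius_twice: "gauss_cong (?z ^ p\<^sup>2) ?z p"
    by (simp add: power2_eq_square power_mult)
  define e where "e = (r - 1) + (p\<^sup>2 - 1) * t"
  have "p\<^sup>2 \<ge> 1"
    using prime_gt_0_nat[OF assms(1)] by simp
  then have exps: "r + (p\<^sup>2 - 1) * Suc t = p\<^sup>2 + e" "r + (p\<^sup>2 - 1) * t = Suc e"
    using assms(3) by (simp_all add: e_def)
  have "gauss_cong (?z ^ p\<^sup>2 * ?z ^ e) (?z * ?z ^ e) p"
    by (intro gauss_cong_mult frobenius_twice gauss_cong_refl) auto
  also have "?z * ?z ^ e = ?z ^ (r + (p\<^sup>2 - 1) * t)"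
    by (simp only: exps power_Suc)
  also note Suc.IH
  finally show ?case
    by (simp only: exps power_add)
qed auto

text \<open>
  Otherwise neither of \<open>a\<close>, \<open>b\<close> is divisible by \<open>p\<close>. Raising \<open>a\<^sup>2 \<equiv> - b\<^sup>2\<close> to the power
  \<open>(p - 1) / 2\<close>, which is odd, turns it into \<open>1 \<equiv> - 1\<close> by Fermat's little theorem.
\<close>

lemma sum_two_squares_dvd:
  fixes a b p :: nat
  assumes "prime p" "p mod 4 = 3" "p dvd a\<^sup>2 + b\<^sup>2"
  shows "p dvd a \<and> p dvd b"
proof -
  have half: "p - 1 = 2 * ((p - 1) div 2)" "odd ((p - 1) div 2)"
    using assms(2) by presburger+
  have "p dvd b" if "p dvd a"
    using that assms(1,3) by (metis dvd_add_right_iff power2_eq_square prime_dvd_mult_iff)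
  moreover have "p dvd a" if "p dvd b"
    using that assms(1,3) by (metis dvd_add_left_iff power2_eq_square prime_dvd_mult_iff)
  moreover have False if "\<not> p dvd a" "\<not> p dvd b"
  proof -
    let ?h = "(p - 1) div 2"
    have "[(int a)\<^sup>2 = - (int b)\<^sup>2] (mod int p)"
      using assms(3) by (simp add: cong_iff_dvd_diff flip: of_nat_power of_nat_add int_dvd_int_iff)
    then have "[((int a)\<^sup>2) ^ ?h = (- (int b)\<^sup>2) ^ ?h] (mod int p)"
      by (rule cong_pow)
    then have *: "[int a ^ (p - 1) = - (int b ^ (p - 1))] (mod int p)"
      using half by (metis power_minus_odd power_mult)
    have "[int (a ^ (p - 1)) = int 1] (mod int p)" "[int (b ^ (p - 1)) = int 1] (mod int p)"
      using fermat_theorem[OF assms(1)] that by (simp_all only: cong_int_iff)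
    then have "[1 = - 1] (mod int p)"
      using * by (metis cong_sym cong_trans cong_minus_minus_iff of_nat_1 of_nat_power)
    then have "int p dvd 2"
      by (simp add: cong_iff_dvd_diff)
    then have "p \<le> 2"
      by (auto dest: zdvd_imp_le)
    then show False
      using assms(2) by auto
  qed
  ultimately show ?thesis
    by blast
qed

text \<open>
  The summand is \<open>(a\<^sup>2 + b\<^sup>2)\<^sup>p\<^sup>-\<^sup>1\<close>, which is \<open>1\<close> modulo \<open>p\<close> except at the zero residue,
  represented here by \<open>a = b = p\<close>. So the sum counts the \<open>p\<^sup>2 - 1\<close> nonzero residues.
\<close>

lemma norm_power_sum:
  assumes "prime p" "p mod 4 = 3"
  shows "gauss_cong (\<Sum>a=1..p. \<Sum>b=1..p.
      (of_nat a + of_nat b * \<i>) ^ (p - 1) * (of_nat a - of_nat b * \<i>) ^ (p - 1)) (- 1) p"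
proof -
  have p: "p \<ge> 1"
    using prime_gt_0_nat[OF assms(1)] by simp
  have "gauss_cong ((of_nat a + of_nat b * \<i>) ^ (p - 1) * (of_nat a - of_nat b * \<i>) ^ (p - 1))
      (of_bool (\<not> (a = p \<and> b = p))) p" if "a \<in> {1..p}" "b \<in> {1..p}" for a b
  proof -
    have norm: "(of_nat a + of_nat b * \<i>) ^ (p - 1) * (of_nat a - of_nat b * \<i>) ^ (p - 1) =
        of_nat ((a\<^sup>2 + b\<^sup>2) ^ (p - 1))"
      by (simp add: power2_eq_square algebra_simps flip: power_mult_distrib)
    have "p - 1 > 0"
      using assms(2) by presburger
    have "[(a\<^sup>2 + b\<^sup>2) ^ (p - 1) = of_bool (\<not> (a = p \<and> b = p))] (mod p)"
    proof (cases "a = p \<and> b = p")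
      case True
      then have "p dvd (a\<^sup>2 + b\<^sup>2) ^ (p - 1)"
        using \<open>p - 1 > 0\<close> by (simp add: power2_eq_square dvd_power_le dvd_trans[OF _ dvd_power])
      with True show ?thesis
        by (simp add: cong_0_iff)
    next
      case False
      then have "\<not> p dvd a\<^sup>2 + b\<^sup>2"
        using that sum_two_squares_dvd[OF assms, of a b] dvd_imp_le[of p a] dvd_imp_le[of p b] by auto
      then show ?thesis
        using fermat_theorem[OF assms(1)] False by simp
    qed
    then show ?thesis
      unfolding norm using of_nat_gauss_cong by fastforce
  qed
  then have "gauss_cong (\<Sum>a=1..p. \<Sum>b=1..p.
      (of_nat a + of_nat b * \<i>) ^ (p - 1) * (of_nat a - of_nat b * \<i>) ^ (p - 1))
      (\<Sum>a=1..p. \<Sum>b=1..p. of_bool (\<not> (a = p \<and> b = p))) p"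
    by (intro gauss_cong_sum)
  also have "(\<Sum>a=1..p. \<Sum>b=1..p. of_bool (\<not> (a = p \<and> b = p))) = (of_nat p * of_nat p - 1 :: complex)"
  proof -
    have "(\<Sum>a=1..p. \<Sum>b=1..p. of_bool (\<not> (a = p \<and> b = p)) :: complex) =
        (\<Sum>a=1..p. \<Sum>b=1..p. 1 - (if a = p then if b = p then 1 else 0 else 0))"
      by (intro sum.cong refl) auto
    also have "\<dots> = of_nat p * of_nat p - (\<Sum>a=1..p. if a = p then (\<Sum>b=1..p. if b = p then 1 else 0) else 0)"
      unfolding sum_subtractf by (intro arg_cong2[where f = minus] sum.cong refl) auto
    also have "\<dots> = of_nat p * of_nat p - 1"
      using p by (simp add: sum.delta)
    finally show ?thesis .
  qed
  also have "gauss_cong (of_nat p * of_nat p - 1) (- 1) p"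
    by (rule gauss_congI[where u = "of_nat p"]) auto
  finally show ?thesis .
qed

text \<open>
  Reduce the exponent to the range from \<open>1\<close> to \<open>p\<^sup>2 - 1\<close> and write it in base \<open>p\<close>. By the
  Frobenius congruence the second digit becomes an exponent of the conjugate, so the summand has
  the sum of the two digits as its degree in the coordinates. The degree argument gives \<open>0\<close>
  unless both digits are \<open>p - 1\<close>, and this happens precisely when \<open>p\<^sup>2 - 1\<close> divides \<open>k\<close>.
\<close>

lemma gauss_power_sum_inert_prime:
  assumes "prime p" "p mod 4 = 3" "k \<ge> 1"
  shows "gauss_cong (gauss_power_sum k p) (if (p\<^sup>2 - 1) dvd k then - 1 else 0) p"
proof -
  have p: "p \<ge> 2"
    using prime_ge_2_nat[OF assms(1)] .
  define N where "N = p\<^sup>2 - 1"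
  have N: "N = (p - 1) + p * (p - 1)" "N > 0"
  proof -
    obtain q where "p = Suc q" "q > 0"
      using p by (cases p) auto
    then show "N = (p - 1) + p * (p - 1)" "N > 0"
      by (simp_all add: N_def power2_eq_square)
  qed
  \<comment> \<open>Shifted by one, so that multiples of \<open>N\<close> are represented by \<open>N\<close> rather than by \<open>0\<close>.\<close>
  define r where "r = (k - 1) mod N + 1"
  have k: "k = r + N * ((k - 1) div N)"
    using assms(3) mod_mult_div_eq[of "k - 1" N] unfolding r_def by linarith
  have r: "r \<ge> 1" "r \<le> N"
    using N(2) by (auto simp: r_def Suc_leI)
  have dvd_iff: "N dvd k \<longleftrightarrow> r = N"
  proof
    assume "N dvd k"
    then have "N dvd r"
      using k by (metis dvd_add_left_iff dvd_triv_left)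
    then show "r = N"
      using r by (auto dest: dvd_imp_le)
  next
    assume "r = N" then show "N dvd k"
      using k by (metis dvd_add dvd_refl dvd_triv_left)
  qed
  define k\<^sub>0 where "k\<^sub>0 = r mod p"
  define k\<^sub>1 where "k\<^sub>1 = r div p"
  have digits: "r = k\<^sub>0 + p * k\<^sub>1" "k\<^sub>0 \<le> p - 1"
    using p mod_less_divisor[of p r] unfolding k\<^sub>0_def k\<^sub>1_def by (simp, linarith)
  have k1: "k\<^sub>1 \<le> p - 1"
  proof -
    have "r < p * p"
      using r N p by (auto simp: N_def power2_eq_square)
    then have "k\<^sub>1 < p"
      unfolding k\<^sub>1_def by (simp add: less_mult_imp_div_less)
    then show ?thesis by simp
  qed
  have "gauss_cong ((of_nat a + of_nat b * \<i>) ^ k)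
      ((of_nat a + of_nat b * \<i>) ^ k\<^sub>0 * (of_nat a - of_nat b * \<i>) ^ k\<^sub>1) p" for a b
  proof -
    let ?z = "of_nat a + of_nat b * \<i>"
    have "gauss_cong (?z ^ (r + N * ((k - 1) div N))) (?z ^ r) p"
      unfolding N_def using assms r(1) by (intro gauss_power_mod_period)
    then have "gauss_cong (?z ^ k) (?z ^ r) p"
      using k by simp
    also have "?z ^ r = ?z ^ k\<^sub>0 * (?z ^ p) ^ k\<^sub>1"
      by (simp add: digits(1) power_add power_mult)
    also have "gauss_cong (?z ^ k\<^sub>0 * (?z ^ p) ^ k\<^sub>1) (?z ^ k\<^sub>0 * (of_nat a - of_nat b * \<i>) ^ k\<^sub>1) p"
      by (intro gauss_cong_mult gauss_cong_power gauss_frobenius assms gauss_cong_refl) auto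
    finally show ?thesis .
  qed
  then have main: "gauss_cong (gauss_power_sum k p) (\<Sum>a=1..p. \<Sum>b=1..p.
      (of_nat a + of_nat b * \<i>) ^ k\<^sub>0 * (of_nat a - of_nat b * \<i>) ^ k\<^sub>1) p"
    unfolding gauss_power_sum_def by (rule gauss_cong_sum[OF gauss_cong_sum])
  show ?thesis
  proof (cases "r = N")
    case True
    have "k\<^sub>0 = (p - 1) mod p"
      unfolding k\<^sub>0_def True N(1) by (rule mod_mult_self2)
    moreover have "k\<^sub>1 = (p - 1) + (p - 1) div p"
      unfolding k\<^sub>1_def True N(1) using p by (intro div_mult_self2) auto
    ultimately have "k\<^sub>0 = p - 1" "k\<^sub>1 = p - 1"
      using p by simp_all
    with main True dvd_iff show ?thesis
      using gauss_cong_trans[OF _ norm_power_sum[OF assms(1,2)]] by (simp add: N_def)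
  next
    case False
    have "k\<^sub>0 + k\<^sub>1 < 2 * (p - 1)"
    proof (rule ccontr)
      assume "\<not> ?thesis"
      with digits(2) k1 have "k\<^sub>0 = p - 1" "k\<^sub>1 = p - 1"
        by linarith+
      with digits(1) N(1) False show False
        by simp
    qed
    with main False dvd_iff show ?thesis
      using gauss_cong_trans[OF _ sum_conj_monomials_vanish[OF assms(1)]] by (simp add: N_def)
  qed
qed

section \<open>Split primes\<close>

lemma sum_power_shift_mod:
  fixes c :: int
  shows "[(\<Sum>a=1..p. (int a + c) ^ k) = (\<Sum>a=1..p. int a ^ k)] (mod int p)"
proof -
  let ?h = "\<lambda>c. \<Sum>a=1..p. (int a + c) ^ k"
  have step: "[?h (c + 1) = ?h c] (mod int p)" for c
  proof -
    have "?h (c + 1) - ?h c = (\<Sum>a=1..p. (int (Suc a) + c) ^ k - (int a + c) ^ k)"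
      by (simp add: sum_subtractf algebra_simps)
    also have "\<dots> = (int p + 1 + c) ^ k - (1 + c) ^ k"
      using sum_Suc_diff[of 1 p "\<lambda>a. (int a + c) ^ k"] by (simp add: algebra_simps)
    finally have "?h (c + 1) - ?h c = (int p + 1 + c) ^ k - (1 + c) ^ k" .
    moreover have "[(int p + 1 + c) ^ k = (1 + c) ^ k] (mod int p)"
      by (intro cong_pow) (simp add: cong_iff_dvd_diff)
    ultimately show ?thesis
      by (simp add: cong_iff_dvd_diff)
  qed
  have "[?h c = ?h 0] (mod int p)"
  proof (induction c rule: int_induct[where k = 0])
    case (step1 c)
    show ?case by (rule cong_trans[OF step step1.IH])
  next
    case (step2 c)
    have "[?h c = ?h (c - 1)] (mod int p)"
      using step[of "c - 1"] by simp
    from cong_trans[OF cong_sym[OF this] step2.IH] show ?case .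
  qed simp
  then show ?thesis
    by simp
qed

text \<open>
  Modulo \<open>p\<close> the factor \<open>s + \<i>\<close> is annihilated by \<open>s - \<i>\<close>; next to it, \<open>\<i>\<close> may therefore
  be replaced by \<open>s\<close>. What is left is a sum of powers of the integers \<open>a + b s\<close>. For every fixed
  \<open>b\<close> these run through all residues, so the inner sums agree for the \<open>p\<close> values of \<open>b\<close>, and
  the total is a multiple of \<open>p\<close>.
\<close>

lemma gauss_power_sum_root_of_minus_one:
  assumes "int p dvd s\<^sup>2 + 1"
  shows "gauss_cong ((of_int s + \<i>) * gauss_power_sum k p) 0 p"
proof -
  have eval: "gauss_cong ((of_int s + \<i>) * (of_nat a + of_nat b * \<i>) ^ j)
      ((of_int s + \<i>) * of_int ((int a + int b * s) ^ j)) p" for a b j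
  proof (induction j)
    case (Suc j)
    let ?z = "of_nat a + of_nat b * \<i>" and ?w = "int a + int b * s"
    obtain r where r: "s\<^sup>2 + 1 = int p * r"
      using assms by blast
    have "of_int (s\<^sup>2 + 1) = (of_int (int p * r) :: complex)"
      by (simp only: r)
    then have s2: "of_int s * of_int s = (of_nat p * of_int r - 1 :: complex)"
      by (simp add: power2_eq_square algebra_simps)
    have "(of_int s + \<i>) * ?z - (of_int s + \<i>) * of_int ?w = - (of_nat b * (of_int s * of_int s + 1))"
      by (simp add: algebra_simps)
    then have "(of_int s + \<i>) * ?z - (of_int s + \<i>) * of_int ?w = of_nat p * - (of_nat b * of_int r)"
      by (simp add: s2 mult_ac)
    then have base: "gauss_cong ((of_int s + \<i>) * ?z) ((of_int s + \<i>) * of_int ?w) p"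
      by (intro gauss_congI[where u = "- (of_nat b * of_int r)"]) auto
    have "gauss_cong ((of_int s + \<i>) * ?z ^ j * ?z) ((of_int s + \<i>) * of_int (?w ^ j) * ?z) p"
      by (intro gauss_cong_mult Suc.IH gauss_cong_refl) auto
    also have "(of_int s + \<i>) * of_int (?w ^ j) * ?z = of_int (?w ^ j) * ((of_int s + \<i>) * ?z)"
      by (simp only: mult_ac)
    also have "gauss_cong (of_int (?w ^ j) * ((of_int s + \<i>) * ?z))
        (of_int (?w ^ j) * ((of_int s + \<i>) * of_int ?w)) p"
      by (intro gauss_cong_mult base gauss_cong_refl gauss_ints_closed)
    finally show ?case
      by (simp add: mult_ac)
  qed auto
  let ?T = "\<Sum>a=1..p. \<Sum>b=1..p. (int a + int b * s) ^ k"
  have "gauss_cong (\<Sum>a=1..p. \<Sum>b=1..p. (of_int s + \<i>) * (of_nat a + of_nat b * \<i>) ^ k)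
      (\<Sum>a=1..p. \<Sum>b=1..p. (of_int s + \<i>) * of_int ((int a + int b * s) ^ k)) p"
    by (rule gauss_cong_sum[OF gauss_cong_sum[OF eval]])
  then have "gauss_cong ((of_int s + \<i>) * gauss_power_sum k p) ((of_int s + \<i>) * of_int ?T) p"
    unfolding gauss_power_sum_def by (simp only: sum_distrib_left of_int_sum)
  also have "gauss_cong ((of_int s + \<i>) * of_int ?T) 0 p"
  proof -
    have "?T = (\<Sum>b=1..p. \<Sum>a=1..p. (int a + int b * s) ^ k)"
      by (rule sum.swap)
    also have "[\<dots> = (\<Sum>b=1..p. \<Sum>a=1..p. int a ^ k)] (mod int p)"
      by (intro cong_sum sum_power_shift_mod)
    also have "(\<Sum>b=1..p. \<Sum>a=1..p. int a ^ k) = int p * (\<Sum>a=1..p. int a ^ k)"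
      by simp
    also have "[int p * (\<Sum>a=1..p. int a ^ k) = 0] (mod int p)"
      by (simp add: cong_0_iff)
    finally have "gauss_cong (of_int ?T) 0 p"
      using of_int_gauss_cong[of ?T 0 p] by simp
    then show ?thesis
      by (intro gauss_cong_mult_0) auto
  qed
  finally show ?thesis .
qed

text \<open>
  Both square roots \<open>s\<close> and \<open>- s\<close> of \<open>- 1\<close> modulo \<open>p\<close> annihilate the sum in the form
  \<open>(\<plusminus> s + \<i>) G \<equiv> 0\<close>. Their difference \<open>2 s\<close> is invertible, so the sum itself vanishes. This
  plays the role of the splitting of \<open>\<int>[\<i>] / p\<close> into two fields.
\<close>

lemma gauss_power_sum_split_prime:
  assumes "prime p" "p mod 4 = 1"
  shows "gauss_cong (gauss_power_sum k p) 0 p"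
proof -
  have p: "p > 2"
    using assms prime_ge_2_nat[of p] by (cases "p = 2") auto
  obtain s where s: "[s\<^sup>2 = - 1] (mod int p)"
  proof -
    have "even ((p - 1) div 2)"
      using assms(2) by presburger
    then have "[Legendre (- 1) (int p) = 1] (mod int p)"
      using euler_criterion[OF assms(1) p, of "- 1"] by simp
    moreover have "\<not> [0 = 1] (mod int p)" "\<not> [- 1 = 1] (mod int p)"
      using p by (auto simp: cong_iff_dvd_diff dest: zdvd_imp_le)
    ultimately have "QuadRes (int p) (- 1)"
      by (auto simp: Legendre_def split: if_splits)
    then show ?thesis
      using that by (auto simp: QuadRes_def)
  qed
  then have dvd: "int p dvd s\<^sup>2 + 1"
    by (simp add: cong_iff_dvd_diff)
  \<comment> \<open>Subtract the congruences for the two roots \<open>s\<close> and \<open>- s\<close>.\<close>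
  have "gauss_cong ((of_int s + \<i>) * gauss_power_sum k p - (of_int (- s) + \<i>) * gauss_power_sum k p) (0 - 0) p"
    using dvd by (intro gauss_cong_diff gauss_power_sum_root_of_minus_one) auto
  then have "gauss_cong (of_int (2 * s) * gauss_power_sum k p) 0 p"
    by (simp add: algebra_simps)
  moreover have "coprime (2 * s) (int p)"
  proof -
    have "\<not> int p dvd 2"
      using p by (auto dest: zdvd_imp_le)
    moreover have "\<not> int p dvd s"
    proof
      assume "int p dvd s"
      then have "int p dvd s\<^sup>2"
        by (simp add: power2_eq_square)
      with dvd have "int p dvd 1"
        using dvd_add_right_iff[of "int p" "s\<^sup>2" 1] by simp
      with p show False by auto
    qed
    ultimately show ?thesis
      using assms(1) by (intro prime_imp_coprime[THEN iffD1[OF coprime_commute]]) (simp_all add: prime_dvd_mult_iff)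
  qed
  ultimately show ?thesis
    by (rule gauss_cong_cancel[OF _ gauss_power_sum_in_gauss_ints])
qed

section \<open>The ramified prime\<close>

text \<open>
  The four summands are \<open>0\<close>, \<open>1\<close>, \<open>\<i>\<^sup>k\<close> and \<open>(1 + \<i>)\<^sup>k\<close> modulo \<open>2\<close>. Since \<open>2\<close> is ramified,
  \<open>(1 + \<i>)\<^sup>2 = 2\<i>\<close>, the last one vanishes as soon as \<open>k > 1\<close>; this is what singles out \<open>k = 1\<close>
  among the odd exponents.
\<close>

lemma gauss_power_sum_2:
  assumes "k \<ge> 1"
  shows "gauss_cong (gauss_power_sum k 2) (if k > 1 \<and> odd k then 1 + \<i> else 0) 2"
proof -
  have expand: "gauss_power_sum k 2 = ((1 + \<i>) ^ k + (1 + of_nat 2 * \<i>) ^ k) + ((of_nat 2 + \<i>) ^ k + (of_nat 2 * (1 + \<i>)) ^ k)"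
    by (simp add: gauss_power_sum_def numeral_2_eq_2 algebra_simps)
  have "gauss_cong (gauss_power_sum k 2) (((1 + \<i>) ^ k + 1 ^ k) + (\<i> ^ k + 0 ^ k)) 2"
    unfolding expand
  proof (intro gauss_cong_add gauss_cong_power gauss_cong_refl)
    show "gauss_cong (1 + of_nat 2 * \<i>) 1 2"
      by (rule gauss_congI[where u = "\<i>"]) auto
    show "gauss_cong (of_nat 2 + \<i>) \<i> 2"
      by (rule gauss_congI[where u = 1]) auto
    show "gauss_cong (of_nat 2 * (1 + \<i>)) 0 2"
      by (rule gauss_congI[where u = "1 + \<i>"]) auto
  qed auto
  also have "((1 + \<i>) ^ k + 1 ^ k) + (\<i> ^ k + 0 ^ k) = (1 + \<i> ^ k) + (1 + \<i>) ^ k"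
    using assms by (simp add: power_0_left)
  finally have main: "gauss_cong (gauss_power_sum k 2) ((1 + \<i> ^ k) + (1 + \<i>) ^ k) 2" .
  show ?thesis
  proof (cases "k = 1")
    case True
    have "gauss_cong ((1 + \<i>) + (1 + \<i>)) 0 2"
      by (rule gauss_congI[where u = "1 + \<i>"]) auto
    with main True have "gauss_cong (gauss_power_sum k 2) 0 2"
      by (auto intro: gauss_cong_trans)
    with True show ?thesis
      by simp
  next
    case False
    then obtain j where j: "k = j + 2"
      using assms that[of "k - 2"] by simp
    have "(1 + \<i>) ^ k = of_nat 2 * (\<i> * (1 + \<i>) ^ j)"
      by (simp add: j power_add power2_eq_square algebra_simps)
    then have ramified: "gauss_cong ((1 + \<i>) ^ k) 0 2"
      by (intro gauss_congI[where u = "\<i> * (1 + \<i>) ^ j"]) auto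
    have "gauss_cong (1 + \<i> ^ k) (if odd k then 1 + \<i> else 0) 2"
    proof (cases "odd k")
      case True
      then obtain l where "k = 2 * l + 1"
        by (auto elim: oddE)
      then have "\<i> ^ k = (- 1) ^ l * \<i>"
        by (simp add: power_mult)
      then have "\<i> ^ k = \<i> \<or> \<i> ^ k = - \<i>"
        by (metis minus_one_power_iff mult_1 mult_minus1)
      moreover have "gauss_cong (1 - \<i>) (1 + \<i>) 2"
        by (rule gauss_congI[where u = "- \<i>"]) auto
      ultimately show ?thesis
        using True by auto
    next
      case False
      then obtain l where "k = 2 * l"
        by (auto elim: evenE)
      then have "\<i> ^ k = (- 1) ^ l"
        by (simp add: power_mult)
      then have "\<i> ^ k = 1 \<or> \<i> ^ k = - 1"
        by (metis minus_one_power_iff)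
      moreover have "gauss_cong 2 0 2"
        by (rule gauss_congI[where u = 1]) auto
      ultimately show ?thesis
        using False by auto
    qed
    from gauss_cong_trans[OF main gauss_cong_add[OF this ramified]] j show ?thesis
      by simp
  qed
qed

section \<open>Assembling the local congruences\<close>

text \<open>
  Periodicity reduces \<open>n\<close> to its \<open>p\<close>-part \<open>p\<^sup>e\<close>, at the cost of the factor \<open>(n / p\<^sup>e)\<^sup>2\<close>.
  For \<open>e \<ge> 2\<close> the sum vanishes, and for \<open>e = 1\<close> the answer depends on whether \<open>p\<close> is ramified,
  split or inert in \<open>\<int>[\<i>]\<close>.
\<close>

lemma gauss_power_sum_local:
  assumes "k \<ge> 1" "prime p" "p dvd n" "n > 0"
  shows "gauss_cong (gauss_power_sum k n)
     (if p \<in> prime_set k n then - ((of_nat (n div p))\<^sup>2)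
      else if p = 2 \<and> k > 1 \<and> odd k \<and> n mod 4 = 2 then (of_nat (n div 2))\<^sup>2 * (1 + \<i>) else 0)
     (p ^ multiplicity p n)" (is "gauss_cong _ ?value _")
proof -
  define e where "e = multiplicity p n"
  have "p ^ e dvd n"
    unfolding e_def by (rule multiplicity_dvd)
  then obtain m where n: "n = p ^ e * m"
    by blast
  have e: "e \<ge> 1"
    using assms unfolding e_def by (simp add: prime_multiplicity_gt_zero_iff Suc_leI)
  have exact: "p\<^sup>2 dvd n \<longleftrightarrow> e \<ge> 2"
    unfolding e_def using assms by (subst power_dvd_iff_le_multiplicity) auto
  have n_mod_4: "n mod 4 = 2 \<longleftrightarrow> e = 1" if "p = 2"
  proof -
    have "4 dvd n \<longleftrightarrow> e \<ge> 2" "2 dvd n"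
      using exact that assms(3) by auto
    then show ?thesis
      using e by presburger
  qed
  have reduce: "gauss_cong (gauss_power_sum k n) ((of_nat m)\<^sup>2 * c) (p ^ e)"
    if "gauss_cong (gauss_power_sum k (p ^ e)) c (p ^ e)" for c
  proof -
    have "gauss_cong ((of_nat m)\<^sup>2 * gauss_power_sum k (p ^ e)) ((of_nat m)\<^sup>2 * c) (p ^ e)"
      using that by (intro gauss_cong_mult gauss_cong_refl) auto
    from gauss_cong_trans[OF gauss_power_sum_periodic this] show ?thesis
      unfolding n .
  qed
  show ?thesis
  proof (cases "e = 1")
    case False
    then have "gauss_cong (gauss_power_sum k (p ^ e)) 0 (p ^ e)"
      using assms(1) e by (intro gauss_power_sum_prime_power) auto
    then have "gauss_cong (gauss_power_sum k n) ((of_nat m)\<^sup>2 * 0) (p ^ e)"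
      by (rule reduce)
    moreover have "p \<notin> prime_set k n" "\<not> (p = 2 \<and> k > 1 \<and> odd k \<and> n mod 4 = 2)"
      using exact e False n_mod_4 by (auto simp: prime_set_def exactly_dvd_def)
    then have "?value = (of_nat m)\<^sup>2 * 0"
      by (simp only: if_False mult_zero_right)
    ultimately show ?thesis
      unfolding e_def by (simp only:)
  next
    case True
    have m: "n div p = m"
      using n True prime_gt_0_nat[OF assms(2)] by simp
    have mem: "p \<in> prime_set k n \<longleftrightarrow> (p\<^sup>2 - 1) dvd k \<and> p mod 4 = 3"
      using assms(2,3) exact True by (auto simp: prime_set_def exactly_dvd_def)
    consider "p = 2" | "p mod 4 = 1" | "p mod 4 = 3"
    proof -
      have "p = 2 \<or> odd p"
        using prime_odd_nat[OF assms(2)] prime_ge_2_nat[OF assms(2)] by linarith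
      then have "p = 2 \<or> p mod 4 = 1 \<or> p mod 4 = 3"
        by presburger
      then show ?thesis
        using that by blast
    qed
    then show ?thesis
    proof cases
      case 1
      then have "p \<notin> prime_set k n"
        unfolding mem by simp
      let ?c = "if k > 1 \<and> odd k then 1 + \<i> else 0"
      have "gauss_cong (gauss_power_sum k n) ((of_nat m)\<^sup>2 * ?c) (p ^ e)"
        by (rule reduce) (use gauss_power_sum_2[OF assms(1)] 1 True in simp)
      moreover have "n div 2 = m" "n mod 4 = 2"
        using m 1 True n_mod_4[OF 1] by simp_all
      then have "?value = (of_nat m)\<^sup>2 * ?c"
        using \<open>p \<notin> prime_set k n\<close> 1 by (cases "odd k"; cases "k > 1") simp_all
      ultimately show ?thesis
        unfolding e_def by (simp only:)
    next
      case 2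
      then have "p \<noteq> 2" "p \<notin> prime_set k n"
        unfolding mem by auto
      then have "?value = (of_nat m)\<^sup>2 * 0"
        by simp
      moreover have "gauss_cong (gauss_power_sum k n) ((of_nat m)\<^sup>2 * 0) (p ^ e)"
        by (rule reduce) (use gauss_power_sum_split_prime[OF assms(2) 2] True in simp)
      ultimately show ?thesis
        unfolding e_def by (simp only:)
    next
      case 3
      let ?c = "if (p\<^sup>2 - 1) dvd k then - 1 else 0"
      from 3 have "p \<noteq> 2"
        by auto
      then have "?value = (of_nat m)\<^sup>2 * ?c"
        unfolding mem m using 3 by simp
      moreover have "gauss_cong (gauss_power_sum k n) ((of_nat m)\<^sup>2 * ?c) (p ^ e)"
        by (rule reduce) (use gauss_power_sum_inert_prime[OF assms(2) 3 assms(1)] True in simp)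
      ultimately show ?thesis
        unfolding e_def by (simp only:)
    qed
  qed
qed

theorem theorem3:
  fixes k n :: nat
  assumes "k \<ge> 1" and "n \<ge> 1"
  shows "gauss_cong (gauss_power_sum k n)
           (if k > 1 \<and> odd k \<and> n mod 4 = 2
            then of_nat n / 2 * (1 + \<i>)
            else - (\<Sum>p\<in>prime_set k n. (of_nat n)\<^sup>2 / (of_nat p)\<^sup>2)) n"
proof (cases "k > 1 \<and> odd k \<and> n mod 4 = 2")
  case True
  define m where "m = n div 2"
  have m: "n = 2 * m" "odd m"
    using True unfolding m_def by presburger+
  \<comment> \<open>For an odd prime \<open>p\<close> the number \<open>p\<^sup>2 - 1\<close> is even, so it cannot divide the odd \<open>k\<close>.\<close>
  have empty: "p \<notin> prime_set k n" for p
  proof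
    assume "p \<in> prime_set k n"
    then have p: "(p\<^sup>2 - 1) dvd k" "p mod 4 = 3"
      by (auto simp: prime_set_def)
    have "odd p"
      using p(2) by presburger
    then have "even (p\<^sup>2 - 1)"
      by simp
    then have "even k"
      using p(1) by (rule dvd_trans)
    with True show False
      by simp
  qed
  have "gauss_cong (gauss_power_sum k n) (of_nat m * (1 + \<i>)) n"
  proof (rule gauss_cong_prime_powersI)
    fix p assume p: "prime p" "p dvd n"
    show "gauss_cong (gauss_power_sum k n) (of_nat m * (1 + \<i>)) (p ^ multiplicity p n)"
    proof (cases "p = 2")
      case 2: True
      have "multiplicity 2 n = 1"
      proof (rule multiplicity_eqI)
        show "\<not> 2 ^ Suc 1 dvd n"
          using True by (simp add: dvd_eq_mod_eq_0)
      qed (use m in auto)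
      then have "gauss_cong (gauss_power_sum k n) ((of_nat m)\<^sup>2 * (1 + \<i>)) 2"
        using gauss_power_sum_local[OF assms(1) p] assms(2) 2 True empty
        by (simp add: m_def)
      \<comment> \<open>The local factor \<open>m\<^sup>2\<close> may be replaced by \<open>m\<close>, both being odd.\<close>
      also have "gauss_cong ((of_nat m)\<^sup>2 * (1 + \<i>)) (of_nat m * (1 + \<i>)) 2"
      proof -
        have "[m\<^sup>2 = m] (mod 2)"
          using m(2) by (simp add: cong_def mod_2_eq_odd)
        then have "gauss_cong (of_nat (m\<^sup>2)) (of_nat m) 2"
          by (rule of_nat_gauss_cong)
        then show ?thesis
          unfolding of_nat_power by (intro gauss_cong_mult gauss_cong_refl) auto
      qed
      finally show ?thesis
        using 2 \<open>multiplicity 2 n = 1\<close> by simp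
    next
      case False
      have "gauss_cong (gauss_power_sum k n) 0 (p ^ multiplicity p n)"
        using gauss_power_sum_local[OF assms(1) p] assms(2) False empty by simp
      have "p ^ multiplicity p n dvd m"
      proof -
        have "coprime (p ^ multiplicity p n) 2"
          using primes_coprime[OF p(1) two_is_prime_nat False] by simp
        moreover have "p ^ multiplicity p n dvd 2 * m"
          using multiplicity_dvd[of p n] m(1) by simp
        ultimately show ?thesis
          by (simp add: coprime_dvd_mult_right_iff)
      qed
      then have "gauss_cong (of_nat m * (1 + \<i>)) 0 (p ^ multiplicity p n)"
        by (intro of_nat_mult_gauss_cong_0) auto
      with \<open>gauss_cong (gauss_power_sum k n) 0 _\<close> show ?thesis
        by (rule gauss_cong_trans[OF _ gauss_cong_sym])
    qed
  qed (use assms in auto)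
  moreover have "of_nat n / 2 * (1 + \<i>) = of_nat m * (1 + \<i>)"
    by (simp add: m(1))
  ultimately show ?thesis
    unfolding if_P[OF True] by (simp only:)
next
  case False
  let ?P = "prime_set k n"
  have P: "prime q" "q dvd n" if "q \<in> ?P" for q
    using that by (auto simp: prime_set_def exactly_dvd_def)
  have "?P \<subseteq> {..n}"
  proof
    fix q assume "q \<in> ?P"
    then have "q \<le> n"
      using assms(2) by (intro dvd_imp_le P(2)) auto
    then show "q \<in> {..n}"
      by simp
  qed
  then have fin: "finite ?P"
    by (rule finite_subset) simp
  have "gauss_cong (gauss_power_sum k n) (- (\<Sum>q\<in>?P. (of_nat (n div q))\<^sup>2)) n"
  proof (rule gauss_cong_prime_powersI)
    fix p assume p: "prime p" "p dvd n"
    let ?c = "if p \<in> ?P then (of_nat (n div p))\<^sup>2 else 0 :: complex"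
    have not_exceptional: "\<not> (p = 2 \<and> k > 1 \<and> odd k \<and> n mod 4 = 2)"
      using False by blast
    have "gauss_cong (gauss_power_sum k n) (- ?c) (p ^ multiplicity p n)"
      using gauss_power_sum_local[OF assms(1) p] assms(2) unfolding if_not_P[OF not_exceptional]
      by (cases "p \<in> ?P") simp_all
    moreover have "gauss_cong (- (\<Sum>q\<in>?P. (of_nat (n div q))\<^sup>2)) (- ?c) (p ^ multiplicity p n)"
    proof (rule gauss_cong_uminus)
      \<comment> \<open>The \<open>p\<close>-part of \<open>n\<close> divides \<open>n / q\<close> for every prime \<open>q \<noteq> p\<close>, so only \<open>q = p\<close> can contribute.\<close>
      have "gauss_cong (\<Sum>q\<in>?P. (of_nat (n div q))\<^sup>2)
          (\<Sum>q\<in>?P. if q = p then (of_nat (n div p))\<^sup>2 else 0) (p ^ multiplicity p n)"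
      proof (rule gauss_cong_sum)
        fix q assume q: "q \<in> ?P"
        show "gauss_cong ((of_nat (n div q))\<^sup>2) (if q = p then (of_nat (n div p))\<^sup>2 else 0)
            (p ^ multiplicity p n)"
        proof (cases "q = p")
          case False
          have "coprime (p ^ multiplicity p n) q"
            using p(1) P(1)[OF q] False by (simp add: primes_coprime)
          moreover have "p ^ multiplicity p n dvd q * (n div q)"
            using multiplicity_dvd[of p n] P(2)[OF q] by simp
          ultimately have "p ^ multiplicity p n dvd n div q"
            by (simp add: coprime_dvd_mult_right_iff)
          then show ?thesis
            using False of_nat_mult_gauss_cong_0[of _ "n div q" "of_nat (n div q)"]
            by (simp add: power2_eq_square)
        qed auto
      qed
      then show "gauss_cong (\<Sum>q\<in>?P. (of_nat (n div q))\<^sup>2) ?c (p ^ multiplicity p n)"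
        using fin by (simp add: sum.delta)
    qed
    ultimately show "gauss_cong (gauss_power_sum k n) (- (\<Sum>q\<in>?P. (of_nat (n div q))\<^sup>2)) (p ^ multiplicity p n)"
      by (rule gauss_cong_trans[OF _ gauss_cong_sym])
  qed (use assms in auto)
  moreover have "(\<Sum>q\<in>?P. (of_nat (n div q))\<^sup>2) = (\<Sum>q\<in>?P. (of_nat n)\<^sup>2 / (of_nat q)\<^sup>2 :: complex)"
  proof (intro sum.cong refl)
    fix q assume q: "q \<in> ?P"
    then have "(of_nat (n div q) :: complex) = of_nat n / of_nat q"
      using P(2) by (simp add: of_nat_of_nat_div)
    then show "(of_nat (n div q))\<^sup>2 = ((of_nat n)\<^sup>2 / (of_nat q)\<^sup>2 :: complex)"
      by (simp add: power_divide)
  qed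
  ultimately show ?thesis
    unfolding if_not_P[OF False] by (simp only:)
qed

end
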